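(* Let $(\mathbb{F},\mathcal{R})$ be a simply-typed term rewriting system (STRS) that is compatible with a cost-size interpretation. Then for all valuations $\alpha$ and $\zeta$ and all terms $s,t$ (such that the quantities below are defined) with $s \to_{\mathcal{R}} t$ (one innermost rewrite step), we have $\mathcal{C}'(s)_{\alpha,\zeta} > \mathcal{C}'(t)_{\alpha,\zeta}$ and $[\![s]\!]^{\mathsf{s}}_\alpha \sqsupseteq [\![t]\!]^{\mathsf{s}}_\alpha$.
   Context: Types: fix a nonempty set $\mathbb{B}$ of base types; simple types are $\sigma ::= \iota \mid \sigma \Rightarrow \sigma$ ($\iota\in\mathbb{B}$, $\Rightarrow$ right-associative); order $\mathrm{ord}(\iota)=0$, $\mathrm{ord}(\sigma\Rightarrow\tau)=\max(1+\mathrm{ord}(\sigma),\mathrm{ord}(\tau))$. A signature assigns to each function symbol $\mathsf{f}$ a type of order at most 2, which can be written $\mathsf{f} : (\vec\iota_1\Rightarrow\kappa_1)\Rightarrow\cdots\Rightarrow(\vec\iota_k\Rightarrow\kappa_k)\Rightarrow\nu_1\Rightarrow\cdots\Rightarrow\nu_l\Rightarrow\iota$ with all $\iota$'s, $\kappa$'s, $\nu$'s base types. For each type there are countably many typed variables. Terms are applicative: variables, function symbols, and well-typed applications $s\,t$ (left-associative). A rewrite rule $\ell\to r$ is a pair of terms of the same base type with $\ell=\mathsf{f}\,\ell_1\cdots\ell_m$ and every variable of $r$ occurring in $\ell$; an STRS is a set $\mathcal{R}$ of such rules. A redex is an instance $\ell\gamma$ of a left-hand side. The innermost rewrite relation: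 $\ell\gamma\to_{\mathcal{R}} r\gamma$ if $\ell\to r\in\mathcal{R}$ and no proper subterm of $\ell\gamma$ is a redex; and if $s\to_{\mathcal{R}} u$ then $s\,t\to_{\mathcal{R}} u\,t$ and $t\,s\to_{\mathcal{R}} t\,u$. Normal form means irreducible for $\to_{\mathcal{R}}$. Cost-size interpretations: for each base type $\iota$ a quasi-ordered set $(\mathcal{S}_\iota,\sqsupseteq_\iota)$ is chosen; $\mathcal{S}_{\sigma\Rightarrow\tau}$ is the set of order-preserving functions $\mathcal{S}_\sigma\to\mathcal{S}_\tau$, ordered by $f\sqsupseteq g$ iff $f(x)\sqsupseteq g(x)$ for all $x$. For types of order $\le 2$: $\mathcal{C}_\kappa=\mathbb{N}$ for $\kappa$ base; $\mathcal{C}_{\iota\Rightarrow\tau}=\mathcal{S}_\iota\Longrightarrow\mathcal{C}_\tau$ for $\iota$ base; $\mathcal{C}_{\sigma\Rightarrow\tau}=\mathcal{C}_\sigma\Longrightarrow\mathcal{S}_\sigma\Longrightarrow\mathcal{C}_\tau$ if $\mathrm{ord}(\sigma)=1$, where $A\Longrightarrow B$ denotes order-preserving functions. A cost-size interpretation assigns to each symbol $\mathsf{f}$ of type $\sigma$ a size $\mathcal{J}^{\mathsf{s}}_{\mathsf{f}}\in\mathcal{S}_\sigma$ and a cost $\mathcal{J}^{\mathsf{c}}_{\mathsf{f}}\in\mathcal{C}_\sigma$. Given valuations $\alpha$ (mapping variables of type $\sigma$ into $\mathcal{S}_\sigma$) and $\zeta$ (mapping variables of type $\sigma$ into $\mathcal{C}_\sigma$):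 $[\![x]\!]^{\mathsf{s}}_\alpha=\alpha(x)$, $[\![\mathsf{f}]\!]^{\mathsf{s}}_\alpha=\mathcal{J}^{\mathsf{s}}_{\mathsf{f}}$, $[\![s\,t]\!]^{\mathsf{s}}_\alpha=[\![s]\!]^{\mathsf{s}}_\alpha([\![t]\!]^{\mathsf{s}}_\alpha)$. For terms $s$ such that $s$ and all its variables have type order $0$ or $1$, the cost is $[\![x\,s_1\cdots s_n]\!]^{\mathsf{c}}_{\alpha,\zeta}=\zeta(x)([\![s_1]\!]^{\mathsf{s}}_\alpha,\dots,[\![s_n]\!]^{\mathsf{s}}_\alpha)$ and $[\![\mathsf{f}\,s_1\cdots s_k\,t_1\cdots t_n]\!]^{\mathsf{c}}_{\alpha,\zeta}=\mathcal{J}^{\mathsf{c}}_{\mathsf{f}}([\![s_1]\!]^{\mathsf{c}}_{\alpha,\zeta},[\![s_1]\!]^{\mathsf{s}}_\alpha,\dots,[\![s_k]\!]^{\mathsf{c}}_{\alpha,\zeta},[\![s_k]\!]^{\mathsf{s}}_\alpha,[\![t_1]\!]^{\mathsf{s}}_\alpha,\dots,[\![t_n]\!]^{\mathsf{s}}_\alpha)$, where $s_1,\dots,s_k$ are the $k$ order-1 arguments of $\mathsf{f}$ and $t_1,\dots,t_n$ ($n\le l$) its base-type arguments. Define $\mathcal{C}(s)_{\alpha,\zeta}=\sum\{[\![t]\!]^{\mathsf{c}}_{\alpha,\zeta}\mid t \text{ a subterm of } s,\ t \text{ not a variable},\ t\text{ of base type}\}$ and $\mathcal{C}'(s)_{\alpha,\zeta}=\sum\{[\![t]\!]^{\mathsf{c}}_{\alpha,\zeta}\mid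 t\text{ a subterm of }s,\ t\text{ not a variable, of base type, not in normal form}\}$. The STRS is compatible with the interpretation if for every rule $\ell\to r$ and all valuations $\alpha,\zeta$: $[\![\ell]\!]^{\mathsf{c}}_{\alpha,\zeta}>\mathcal{C}(r)_{\alpha,\zeta}$ and $[\![\ell]\!]^{\mathsf{s}}_\alpha\sqsupseteq[\![r]\!]^{\mathsf{s}}_\alpha$. *)

theory Defs
  imports Main "HOL-Library.FuncSet" "HOL-Library.Multiset"
begin

datatype 'b ty = Base 'b | Arrow "'b ty" "'b ty"  (infixr \<open>\<Rrightarrow>\<close> 65)

primrec ord :: "'b ty \<Rightarrow> nat" where
  "ord (Base \<iota>) = 0"
| "ord (\<sigma> \<Rrightarrow> \<tau>) = max (1 + ord \<sigma>) (ord \<tau>)"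

text \<open>The variables of type \<open>\<sigma>\<close> are the pairs \<open>(n, \<sigma>)\<close>.\<close>

type_synonym 'b var = "nat \<times> 'b ty"

datatype ('f, 'b) trm =
    Var "'b var"
  | Sym 'f
  | App "('f, 'b) trm" "('f, 'b) trm"  (infixl \<open>\<cdot>\<close> 80)

text \<open>A signature is a map \<open>F :: 'f \<Rightarrow> 'b ty\<close>. Elements of \<^typ>\<open>('f, 'b) trm\<close> are raw; the
  terms of the mathematics are those that have a type.\<close>

inductive has_type :: "('f \<Rightarrow> 'b ty) \<Rightarrow> ('f, 'b) trm \<Rightarrow> 'b ty \<Rightarrow> bool" for F where
  "has_type F (Var x) (snd x)"
| "has_type F (Sym f) (F f)"
| "has_type F s (\<sigma> \<Rrightarrow> \<tau>) \<Longrightarrow> has_type F t \<sigma> \<Longrightarrow> has_type F (s \<cdot> t) \<tau>"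

text \<open>Arguments of order 1 come first, then the arguments of base type. A type of order 1
  is exactly one of the form \<open>\<iota>\<^sub>1 \<Rrightarrow> \<dots> \<Rrightarrow> \<iota>\<^sub>n \<Rrightarrow> \<kappa>\<close> with base types and \<open>n \<ge> 1\<close>.\<close>

definition signature :: "('f \<Rightarrow> 'b ty) \<Rightarrow> bool" where
  "signature F \<longleftrightarrow>
     (\<forall>f. \<exists>\<sigma>s \<nu>s \<iota>. F f = foldr Arrow \<sigma>s (foldr Arrow (map Base \<nu>s) (Base \<iota>)) \<and>
            (\<forall>\<sigma>\<in>set \<sigma>s. ord \<sigma> = 1))"

primrec vars :: "('f, 'b) trm \<Rightarrow> 'b var set" where
  "vars (Var x) = {x}"
| "vars (Sym f) = {}"
| "vars (s \<cdot> t) = vars s \<union> vars t"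

text \<open>Subterms with multiplicity: one element for each position.\<close>

primrec subterms :: "('f, 'b) trm \<Rightarrow> ('f, 'b) trm multiset" where
  "subterms (Var x) = {#Var x#}"
| "subterms (Sym f) = {#Sym f#}"
| "subterms (s \<cdot> t) = add_mset (s \<cdot> t) (subterms s + subterms t)"

primrec subst :: "('b var \<Rightarrow> ('f, 'b) trm) \<Rightarrow> ('f, 'b) trm \<Rightarrow> ('f, 'b) trm" where
  "subst \<gamma> (Var x) = \<gamma> x"
| "subst \<gamma> (Sym f) = Sym f"
| "subst \<gamma> (s \<cdot> t) = subst \<gamma> s \<cdot> subst \<gamma> t"

definition substitution :: "('f \<Rightarrow> 'b ty) \<Rightarrow> ('b var \<Rightarrow> ('f, 'b) trm) \<Rightarrow> bool" where
  "substitution F \<gamma> \<longleftrightarrow> (\<forall>x. has_type F (\<gamma> x) (snd x))"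


type_synonym ('f, 'b) rules = "(('f, 'b) trm \<times> ('f, 'b) trm) set"

definition strs :: "('f \<Rightarrow> 'b ty) \<Rightarrow> ('f, 'b) rules \<Rightarrow> bool" where
  "strs F R \<longleftrightarrow> signature F \<and>
     (\<forall>(l, r)\<in>R. (\<exists>\<iota>. has_type F l (Base \<iota>) \<and> has_type F r (Base \<iota>)) \<and>
                 (\<exists>f ls. l = foldl App (Sym f) ls) \<and> vars r \<subseteq> vars l)"

definition redex :: "('f \<Rightarrow> 'b ty) \<Rightarrow> ('f, 'b) rules \<Rightarrow> ('f, 'b) trm \<Rightarrow> bool" where
  "redex F R u \<longleftrightarrow> (\<exists>l r \<gamma>. (l, r) \<in> R \<and> substitution F \<gamma> \<and> u = subst \<gamma> l)"

inductive step :: "('f \<Rightarrow> 'b ty) \<Rightarrow> ('f, 'b) rules \<Rightarrow> ('f, 'b) trm \<Rightarrow> ('f, 'b) trm \<Rightarrow> bool"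
  for F R where
  root: "(l, r) \<in> R \<Longrightarrow> substitution F \<gamma> \<Longrightarrow>
     (\<And>u. u \<in># subterms (subst \<gamma> l) \<Longrightarrow> u \<noteq> subst \<gamma> l \<Longrightarrow> \<not> redex F R u) \<Longrightarrow>
     step F R (subst \<gamma> l) (subst \<gamma> r)"
| left: "step F R s u \<Longrightarrow> step F R (s \<cdot> t) (u \<cdot> t)"
| right: "step F R s u \<Longrightarrow> step F R (t \<cdot> s) (t \<cdot> u)"

definition normal_form :: "('f \<Rightarrow> 'b ty) \<Rightarrow> ('f, 'b) rules \<Rightarrow> ('f, 'b) trm \<Rightarrow> bool" where
  "normal_form F R s \<longleftrightarrow> (\<nexists>t. step F R s t)"


text \<open>The set \<open>A \<Longrightarrow> B\<close> of order-preserving functions between quasi-ordered sets, and its order.\<close>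

definition mono_funs ::
    "'a set \<Rightarrow> ('a \<Rightarrow> 'a \<Rightarrow> bool) \<Rightarrow> 'c set \<Rightarrow> ('c \<Rightarrow> 'c \<Rightarrow> bool) \<Rightarrow> ('a \<Rightarrow> 'c) set" where
  "mono_funs A geA B geB = {f \<in> A \<rightarrow>\<^sub>E B. monotone_on A geA geB f}"

definition pointwise :: "'a set \<Rightarrow> ('c \<Rightarrow> 'c \<Rightarrow> bool) \<Rightarrow> ('a \<Rightarrow> 'c) \<Rightarrow> ('a \<Rightarrow> 'c) \<Rightarrow> bool" where
  "pointwise A ge f g \<longleftrightarrow> (\<forall>x\<in>A. ge (f x) (g x))"

text \<open>Costs at types of order at most 1 and at most 2. A cost at a type \<open>\<sigma> \<Rrightarrow> \<tau>\<close> of order 2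
  takes the size of an argument of base type, and the cost and the size of an argument of
  order 1.\<close>

datatype 'u cost1 = Num nat | Fn1 "'u \<Rightarrow> 'u cost1"

datatype 'u cost =
    Low "'u cost1"
  | SizeFn "'u \<Rightarrow> 'u cost"
  | CostFn "'u cost1 \<Rightarrow> 'u \<Rightarrow> 'u cost"

text \<open>In a cost-size interpretation all the sets \<open>\<S>\<^sub>\<sigma>\<close> live in one type \<open>'u\<close>, in which an
  element of \<open>\<S>\<close> at \<open>\<sigma> \<Rrightarrow> \<tau>\<close> acts as a function through \<open>size_app\<close>.\<close>

record ('f, 'b, 'u) interp =
  size_dom :: "'b ty \<Rightarrow> 'u set"
  base_ge :: "'b \<Rightarrow> 'u \<Rightarrow> 'u \<Rightarrow> bool"
  size_app :: "'u \<Rightarrow> 'u \<Rightarrow> 'u"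
  size_int :: "'f \<Rightarrow> 'u"
  cost_int :: "'f \<Rightarrow> 'u cost"

primrec size_ge :: "('f, 'b, 'u) interp \<Rightarrow> 'b ty \<Rightarrow> 'u \<Rightarrow> 'u \<Rightarrow> bool" where
  "size_ge I (Base \<iota>) = base_ge I \<iota>"
| "size_ge I (\<sigma> \<Rrightarrow> \<tau>) =
     (\<lambda>f g. pointwise (size_dom I \<sigma>) (size_ge I \<tau>) (size_app I f) (size_app I g))"

text \<open>At each arrow type of order at most \<open>N\<close>, \<open>size_app\<close> identifies the size domain with the
  set of all order-preserving functions. The bound is there because for infinite \<open>\<S>\<^sub>\<iota>\<close> the
  domains of all simple types together need not fit into any HOL type, whereas those of order at
  most \<open>N\<close> do for every \<open>N\<close>; a term only involves types of bounded order.\<close>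

definition size_structure :: "nat \<Rightarrow> ('f, 'b, 'u) interp \<Rightarrow> bool" where
  "size_structure N I \<longleftrightarrow>
     (\<forall>\<iota>. reflp_on (size_dom I (Base \<iota>)) (base_ge I \<iota>) \<and>
           transp_on (size_dom I (Base \<iota>)) (base_ge I \<iota>)) \<and>
     (\<forall>\<sigma> \<tau>. ord (\<sigma> \<Rrightarrow> \<tau>) \<le> N \<longrightarrow>
        bij_betw (\<lambda>f. restrict (size_app I f) (size_dom I \<sigma>)) (size_dom I (\<sigma> \<Rrightarrow> \<tau>))
          (mono_funs (size_dom I \<sigma>) (size_ge I \<sigma>) (size_dom I \<tau>) (size_ge I \<tau>)))"

fun cost1_ge :: "('f, 'b, 'u) interp \<Rightarrow> 'b ty \<Rightarrow> 'u cost1 \<Rightarrow> 'u cost1 \<Rightarrow> bool" where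
  "cost1_ge I (Base \<kappa>) (Num m) (Num n) \<longleftrightarrow> m \<ge> n"
| "cost1_ge I (\<sigma> \<Rrightarrow> \<tau>) (Fn1 c) (Fn1 d) \<longleftrightarrow> pointwise (size_dom I \<sigma>) (cost1_ge I \<tau>) c d"
| "cost1_ge I _ _ _ \<longleftrightarrow> False"

text \<open>Only meaningful at types of order at most 1.\<close>

primrec cost1_dom :: "('f, 'b, 'u) interp \<Rightarrow> 'b ty \<Rightarrow> 'u cost1 set" where
  "cost1_dom I (Base \<kappa>) = range Num"
| "cost1_dom I (\<sigma> \<Rrightarrow> \<tau>) =
     Fn1 ` mono_funs (size_dom I \<sigma>) (size_ge I \<sigma>) (cost1_dom I \<tau>) (cost1_ge I \<tau>)"

fun cost_ge :: "('f, 'b, 'u) interp \<Rightarrow> 'b ty \<Rightarrow> 'u cost \<Rightarrow> 'u cost \<Rightarrow> bool" where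
  "cost_ge I \<sigma> (Low c) (Low d) \<longleftrightarrow> cost1_ge I \<sigma> c d"
| "cost_ge I (\<sigma> \<Rrightarrow> \<tau>) (SizeFn c) (SizeFn d) \<longleftrightarrow> pointwise (size_dom I \<sigma>) (cost_ge I \<tau>) c d"
| "cost_ge I (\<sigma> \<Rrightarrow> \<tau>) (CostFn c) (CostFn d) \<longleftrightarrow>
     pointwise (cost1_dom I \<sigma>) (pointwise (size_dom I \<sigma>) (cost_ge I \<tau>)) c d"
| "cost_ge I _ _ _ \<longleftrightarrow> False"

text \<open>Only meaningful at types of order at most 2.\<close>

primrec cost_dom :: "('f, 'b, 'u) interp \<Rightarrow> 'b ty \<Rightarrow> 'u cost set" where
  "cost_dom I (Base \<kappa>) = Low ` cost1_dom I (Base \<kappa>)"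
| "cost_dom I (\<sigma> \<Rrightarrow> \<tau>) =
     (if ord (\<sigma> \<Rrightarrow> \<tau>) \<le> 1 then Low ` cost1_dom I (\<sigma> \<Rrightarrow> \<tau>)
      else if ord \<sigma> = 0 then
        SizeFn ` mono_funs (size_dom I \<sigma>) (size_ge I \<sigma>) (cost_dom I \<tau>) (cost_ge I \<tau>)
      else
        CostFn ` mono_funs (cost1_dom I \<sigma>) (cost1_ge I \<sigma>)
          (mono_funs (size_dom I \<sigma>) (size_ge I \<sigma>) (cost_dom I \<tau>) (cost_ge I \<tau>))
          (pointwise (size_dom I \<sigma>) (cost_ge I \<tau>)))"

definition cost_size_interpretation ::
    "('f \<Rightarrow> 'b ty) \<Rightarrow> nat \<Rightarrow> ('f, 'b, 'u) interp \<Rightarrow> bool" where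
  "cost_size_interpretation F N I \<longleftrightarrow> size_structure N I \<and>
     (\<forall>f. size_int I f \<in> size_dom I (F f) \<and> cost_int I f \<in> cost_dom I (F f))"


definition size_valuation :: "nat \<Rightarrow> ('f, 'b, 'u) interp \<Rightarrow> ('b var \<Rightarrow> 'u) \<Rightarrow> bool" where
  "size_valuation N I \<alpha> \<longleftrightarrow> (\<forall>x. ord (snd x) \<le> N \<longrightarrow> \<alpha> x \<in> size_dom I (snd x))"

definition cost_valuation :: "('f, 'b, 'u) interp \<Rightarrow> ('b var \<Rightarrow> 'u cost) \<Rightarrow> bool" where
  "cost_valuation I \<zeta> \<longleftrightarrow> (\<forall>x. ord (snd x) \<le> 2 \<longrightarrow> \<zeta> x \<in> cost_dom I (snd x))"

primrec size_of :: "('f, 'b, 'u) interp \<Rightarrow> ('b var \<Rightarrow> 'u) \<Rightarrow> ('f, 'b) trm \<Rightarrow> 'u" where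
  "size_of I \<alpha> (Var x) = \<alpha> x"
| "size_of I \<alpha> (Sym f) = size_int I f"
| "size_of I \<alpha> (s \<cdot> t) = size_app I (size_of I \<alpha> s) (size_of I \<alpha> t)"

text \<open>Application of a cost to the cost and the size of an argument; the cost of an argument of
  base type is discarded.\<close>

fun cost_app :: "'u cost \<Rightarrow> 'u cost \<Rightarrow> 'u \<Rightarrow> 'u cost" where
  "cost_app (Low (Fn1 c)) _ u = Low (c u)"
| "cost_app (SizeFn c) _ u = c u"
| "cost_app (CostFn c) (Low d) u = c d u"
| "cost_app _ _ _ = undefined"

text \<open>Unfolding the recursion along a spine gives \<open>\<zeta> x\<close> applied to the sizes of the arguments,
  and \<open>cost_int I f\<close> applied to the costs and sizes of the arguments of order 1 and then to the
  sizes of the arguments of base type.\<close>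

primrec cost_of :: "('f, 'b, 'u) interp \<Rightarrow> ('b var \<Rightarrow> 'u) \<Rightarrow> ('b var \<Rightarrow> 'u cost) \<Rightarrow>
    ('f, 'b) trm \<Rightarrow> 'u cost" where
  "cost_of I \<alpha> \<zeta> (Var x) = \<zeta> x"
| "cost_of I \<alpha> \<zeta> (Sym f) = cost_int I f"
| "cost_of I \<alpha> \<zeta> (s \<cdot> t) = cost_app (cost_of I \<alpha> \<zeta> s) (cost_of I \<alpha> \<zeta> t) (size_of I \<alpha> t)"

definition cost_defined :: "('f \<Rightarrow> 'b ty) \<Rightarrow> ('f, 'b) trm \<Rightarrow> bool" where
  "cost_defined F s \<longleftrightarrow> (\<exists>\<sigma>. has_type F s \<sigma> \<and> ord \<sigma> \<le> 1) \<and> (\<forall>x\<in>vars s. ord (snd x) \<le> 1)"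

fun nat_of_cost :: "'u cost \<Rightarrow> nat" where
  "nat_of_cost (Low (Num n)) = n"
| "nat_of_cost _ = undefined"

definition base_nonvar :: "('f \<Rightarrow> 'b ty) \<Rightarrow> ('f, 'b) trm \<Rightarrow> bool" where
  "base_nonvar F t \<longleftrightarrow> (\<exists>\<iota>. has_type F t (Base \<iota>)) \<and> (\<nexists>x. t = Var x)"

text \<open>The subterms contributing to \<open>\<C>(s)\<close> and to \<open>\<C>'(s)\<close>. Both sums range over subterm
  occurrences: with each subterm counted once, \<open>\<C>'\<close> would not decrease when one of two copies
  of a redex is contracted.\<close>

definition counted :: "('f \<Rightarrow> 'b ty) \<Rightarrow> ('f, 'b) trm \<Rightarrow> ('f, 'b) trm multiset" where
  "counted F s = {#t \<in># subterms s. base_nonvar F t#}"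

definition counted' :: "('f \<Rightarrow> 'b ty) \<Rightarrow> ('f, 'b) rules \<Rightarrow> ('f, 'b) trm \<Rightarrow> ('f, 'b) trm multiset"
  where "counted' F R s = {#t \<in># subterms s. base_nonvar F t \<and> \<not> normal_form F R t#}"

definition total_cost :: "('f \<Rightarrow> 'b ty) \<Rightarrow> ('f, 'b, 'u) interp \<Rightarrow> ('b var \<Rightarrow> 'u) \<Rightarrow>
    ('b var \<Rightarrow> 'u cost) \<Rightarrow> ('f, 'b) trm \<Rightarrow> nat" where
  "total_cost F I \<alpha> \<zeta> s = (\<Sum>t\<in>#counted F s. nat_of_cost (cost_of I \<alpha> \<zeta> t))"

definition total_cost' :: "('f \<Rightarrow> 'b ty) \<Rightarrow> ('f, 'b) rules \<Rightarrow> ('f, 'b, 'u) interp \<Rightarrow>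
    ('b var \<Rightarrow> 'u) \<Rightarrow> ('b var \<Rightarrow> 'u cost) \<Rightarrow> ('f, 'b) trm \<Rightarrow> nat" where
  "total_cost' F R I \<alpha> \<zeta> s = (\<Sum>t\<in>#counted' F R s. nat_of_cost (cost_of I \<alpha> \<zeta> t))"

text \<open>The two inequalities presuppose that the costs in them are defined.\<close>

definition compatible ::
    "('f \<Rightarrow> 'b ty) \<Rightarrow> ('f, 'b) rules \<Rightarrow> nat \<Rightarrow> ('f, 'b, 'u) interp \<Rightarrow> bool" where
  "compatible F R N I \<longleftrightarrow>
     (\<forall>(l, r)\<in>R. cost_defined F l \<and> (\<forall>t\<in>#counted F r. cost_defined F t) \<and>
        (\<forall>\<alpha> \<zeta>. size_valuation N I \<alpha> \<longrightarrow> cost_valuation I \<zeta> \<longrightarrow>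
           nat_of_cost (cost_of I \<alpha> \<zeta> l) > total_cost F I \<alpha> \<zeta> r \<and>
           (\<forall>\<iota>. has_type F l (Base \<iota>) \<longrightarrow>
              size_ge I (Base \<iota>) (size_of I \<alpha> l) (size_of I \<alpha> r))))"

end

theory Submission imports Defs begin

text \<open>
  A redex \<open>l\<gamma>\<close> of an innermost step has only normal proper subterms, so \<open>\<C>'(l\<gamma>)\<close> is the cost
  of \<open>l\<gamma>\<close> alone, and the subterms of \<open>r\<gamma>\<close> inside \<open>\<gamma> x\<close> do not contribute to \<open>\<C>'(r\<gamma>)\<close>.
  Absorbing \<open>\<gamma>\<close> into the valuations therefore turns compatibility into \<open>\<C>'(l\<gamma>) > \<C>'(r\<gamma>)\<close>.
  In a context every counted subterm above the redex keeps its size and its cost up to the orders,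
  by monotonicity. When \<open>r\<close> is a variable, the cost of the contracted subterm itself may increase,
  but that subterm has base type, and the cost of an argument of base type is discarded.
\<close>

section \<open>Typing, substitution and subterms\<close>

inductive_cases has_type_VarE: "has_type F (Var x) \<sigma>"
inductive_cases has_type_SymE: "has_type F (Sym f) \<sigma>"
inductive_cases has_type_AppE: "has_type F (s \<cdot> t) \<sigma>"

text \<open>Variables carry their types and \<open>F\<close> is a function, so the term determines
  which typing rule applies and with which type.\<close>

lemma has_type_unique: "has_type F s \<sigma> \<Longrightarrow> has_type F s \<tau> \<Longrightarrow> \<sigma> = \<tau>"
proof (induction arbitrary: \<tau> rule: has_type.induct)
  case (3 s \<sigma> \<tau>' t)
  from 3(5) show ?case by (rule has_type_AppE) (use 3 in blast)
qed (auto elim: has_type_VarE has_type_SymE)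

lemma has_type_subst:
  "has_type F s \<sigma> \<Longrightarrow> substitution F \<gamma> \<Longrightarrow> has_type F (subst \<gamma> s) \<sigma>"
  by (induction rule: has_type.induct) (auto simp: substitution_def intro: has_type.intros)

lemma vars_subst: "vars (subst \<gamma> s) = (\<Union>x\<in>vars s. vars (\<gamma> x))"
  by (induction s) auto

lemma size_of_subst:
  "(\<And>x. x \<in> vars s \<Longrightarrow> \<alpha>' x = size_of I \<alpha> (\<gamma> x)) \<Longrightarrow>
    size_of I \<alpha> (subst \<gamma> s) = size_of I \<alpha>' s"
  by (induction s) auto

text \<open>The cost of an application also involves the size of its argument, so both valuations
  must absorb \<open>\<gamma>\<close>. Agreement on \<open>vars s\<close> is enough, which leaves
  their values elsewhere free.\<close>

lemma cost_of_subst: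
  "(\<And>x. x \<in> vars s \<Longrightarrow> \<alpha>' x = size_of I \<alpha> (\<gamma> x)) \<Longrightarrow>
    (\<And>x. x \<in> vars s \<Longrightarrow> \<zeta>' x = cost_of I \<alpha> \<zeta> (\<gamma> x)) \<Longrightarrow>
    cost_of I \<alpha> \<zeta> (subst \<gamma> s) = cost_of I \<alpha>' \<zeta>' s"
proof (induction s)
  case (App s t)
  then show ?case using size_of_subst[of t \<alpha>' I \<alpha> \<gamma>] by simp
qed auto

lemma subterm_refl: "s \<in># subterms s"
  by (cases s) auto

lemma subterms_trans: "u \<in># subterms t \<Longrightarrow> t \<in># subterms s \<Longrightarrow> u \<in># subterms s"
  by (induction s) auto

lemma subterm_size: "u \<in># subterms s \<Longrightarrow> size u \<le> size s"
  by (induction s) auto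

lemma App_not_proper_subterm: "s \<cdot> t \<notin># subterms s" "s \<cdot> t \<notin># subterms t"
  using subterm_size[of "s \<cdot> t" s] subterm_size[of "s \<cdot> t" t] by auto

lemma subst_var_subterm: "x \<in> vars s \<Longrightarrow> \<gamma> x \<in># subterms (subst \<gamma> s)"
  by (induction s) (auto simp: subterm_refl)

text \<open>Used contrapositively: a term none of whose subterms is a redex is a normal
  form.\<close>

lemma step_redex: "step F R s t \<Longrightarrow> \<exists>u. u \<in># subterms s \<and> redex F R u"
  by (induction rule: step.induct) (auto simp: redex_def intro: subterm_refl)

section \<open>Orders of types\<close>

lemma ord_foldr_Arrow:
  "\<forall>\<sigma>\<in>set \<sigma>s. ord \<sigma> \<le> n \<Longrightarrow> ord \<tau> \<le> Suc n \<Longrightarrow> ord (foldr Arrow \<sigma>s \<tau>) \<le> Suc n"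
  by (induction \<sigma>s) auto

lemma signature_ord: "signature F \<Longrightarrow> ord (F f) \<le> 2"
proof -
  assume "signature F"
  then obtain \<sigma>s \<nu>s \<iota> where F: "F f = foldr Arrow \<sigma>s (foldr Arrow (map Base \<nu>s) (Base \<iota>))"
    and \<sigma>s: "\<forall>\<sigma>\<in>set \<sigma>s. ord \<sigma> = 1"
    unfolding signature_def by meson
  have "ord (foldr Arrow (map Base \<nu>s) (Base \<iota>)) \<le> Suc 1"
    by (intro ord_foldr_Arrow) auto
  then have "ord (F f) \<le> Suc 1" unfolding F using \<sigma>s by (intro ord_foldr_Arrow) auto
  then show ?thesis by simp
qed

text \<open>Symbols have order at most 2, and passing from
  \<open>\<sigma> \<Rrightarrow> \<tau>\<close> to \<open>\<tau>\<close> never raises the order.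
  Hence a bound on the variables bounds the types of all subterms, and those types stay in the range
  where the domains have their intended meaning.\<close>

lemma has_type_ord:
  "has_type F s \<sigma> \<Longrightarrow> signature F \<Longrightarrow> 2 \<le> n \<Longrightarrow> \<forall>x\<in>vars s. ord (snd x) \<le> n \<Longrightarrow> ord \<sigma> \<le> n"
proof (induction rule: has_type.induct)
  case (2 f)
  then show ?case using signature_ord[of F f] by simp
qed auto

section \<open>Domains and orders of sizes and costs\<close>

lemma mono_funs_in: "f \<in> mono_funs A geA B geB \<Longrightarrow> x \<in> A \<Longrightarrow> f x \<in> B"
  by (auto simp: mono_funs_def)

lemma mono_funs_mono:
  "f \<in> mono_funs A geA B geB \<Longrightarrow> x \<in> A \<Longrightarrow> y \<in> A \<Longrightarrow> geA x y \<Longrightarrow> geB (f x) (f y)"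
  by (auto simp: mono_funs_def monotone_on_def)

lemma size_structure_app:
  assumes "size_structure N I" "ord (\<sigma> \<Rrightarrow> \<tau>) \<le> N" "f \<in> size_dom I (\<sigma> \<Rrightarrow> \<tau>)"
  shows "x \<in> size_dom I \<sigma> \<Longrightarrow> size_app I f x \<in> size_dom I \<tau>"
    and "x \<in> size_dom I \<sigma> \<Longrightarrow> y \<in> size_dom I \<sigma> \<Longrightarrow> size_ge I \<sigma> x y \<Longrightarrow>
      size_ge I \<tau> (size_app I f x) (size_app I f y)"
proof -
  \<comment> \<open>The bijection of \<open>size_structure\<close> sends \<open>f\<close> to this
    restriction, so its values lie in the set of monotone functions; on the domain the restriction
    agrees with \<open>size_app I f\<close>.\<close>
  have *: "restrict (size_app I f) (size_dom I \<sigma>) \<in>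
      mono_funs (size_dom I \<sigma>) (size_ge I \<sigma>) (size_dom I \<tau>) (size_ge I \<tau>)"
    using assms unfolding size_structure_def by (meson bij_betwE)
  show "x \<in> size_dom I \<sigma> \<Longrightarrow> size_app I f x \<in> size_dom I \<tau>"
    using mono_funs_in[OF *] by fastforce
  show "x \<in> size_dom I \<sigma> \<Longrightarrow> y \<in> size_dom I \<sigma> \<Longrightarrow> size_ge I \<sigma> x y \<Longrightarrow>
      size_ge I \<tau> (size_app I f x) (size_app I f y)"
    using mono_funs_mono[OF *, of x y] by simp
qed

lemma cost1_ge_trans: "cost1_ge I \<sigma> a b \<Longrightarrow> cost1_ge I \<sigma> b c \<Longrightarrow> cost1_ge I \<sigma> a c"
proof (induction \<sigma> arbitrary: a b c)
  case (Base \<iota>)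
  then show ?case by (cases a; cases b; cases c) auto
next
  case (Arrow \<sigma> \<tau>)
  from Arrow.prems obtain f g h where "a = Fn1 f" "b = Fn1 g" "c = Fn1 h"
    by (cases a; cases b; cases c) simp_all
  then show ?case using Arrow.prems by (auto simp: pointwise_def intro: Arrow.IH(2))
qed

text \<open>\<open>cost_ge\<close> is false across different constructors, so the three costs have
  the same shape and transitivity is inherited pointwise. It serves to chain a change of cost with a
  change of size.\<close>

lemma cost_ge_trans: "cost_ge I \<sigma> a b \<Longrightarrow> cost_ge I \<sigma> b c \<Longrightarrow> cost_ge I \<sigma> a c"
proof (induction \<sigma> arbitrary: a b c)
  case (Base \<iota>)
  then show ?case by (cases a; cases b; cases c) (auto intro: cost1_ge_trans)
next
  case (Arrow \<sigma> \<tau>)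
  from Arrow.prems consider
      (Low) f g h where "a = Low f" "b = Low g" "c = Low h"
    | (SizeFn) f g h where "a = SizeFn f" "b = SizeFn g" "c = SizeFn h"
    | (CostFn) f g h where "a = CostFn f" "b = CostFn g" "c = CostFn h"
    by (cases a; cases b; cases c) simp_all
  then show ?case
  proof cases
    case Low
    then show ?thesis using Arrow.prems by (auto intro: cost1_ge_trans)
  next
    case SizeFn
    then show ?thesis using Arrow.prems by (auto simp: pointwise_def intro: Arrow.IH(2))
  next
    case CostFn
    then show ?thesis using Arrow.prems
      by (fastforce simp: pointwise_def intro: Arrow.IH(2))
  qed
qed

lemma cost_dom_low: "ord \<sigma> \<le> 1 \<Longrightarrow> cost_dom I \<sigma> = Low ` cost1_dom I \<sigma>"
  by (cases \<sigma>) auto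

text \<open>At order at most 2 the three branches of \<open>cost_dom\<close> match the three
  constructors, so the type of a cost determines how \<open>cost_app\<close> acts on it.\<close>

lemma cost_dom_ArrowE:
  assumes "c \<in> cost_dom I (\<sigma> \<Rrightarrow> \<tau>)" "ord (\<sigma> \<Rrightarrow> \<tau>) \<le> 2"
  obtains (Low) f where "c = Low (Fn1 f)" "ord \<sigma> = 0" "ord \<tau> \<le> 1"
      "f \<in> mono_funs (size_dom I \<sigma>) (size_ge I \<sigma>) (cost1_dom I \<tau>) (cost1_ge I \<tau>)"
  | (SizeFn) f where "c = SizeFn f" "ord \<sigma> = 0" "ord \<tau> = 2"
      "f \<in> mono_funs (size_dom I \<sigma>) (size_ge I \<sigma>) (cost_dom I \<tau>) (cost_ge I \<tau>)"
  | (CostFn) f where "c = CostFn f" "ord \<sigma> = 1"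
      "f \<in> mono_funs (cost1_dom I \<sigma>) (cost1_ge I \<sigma>)
        (mono_funs (size_dom I \<sigma>) (size_ge I \<sigma>) (cost_dom I \<tau>) (cost_ge I \<tau>))
        (pointwise (size_dom I \<sigma>) (cost_ge I \<tau>))"
proof -
  consider "ord (\<sigma> \<Rrightarrow> \<tau>) \<le> 1" | "ord \<sigma> = 0" "ord \<tau> = 2" | "ord \<sigma> = 1"
    using assms(2) by (simp, linarith)
  then show thesis
  proof cases
    case 1
    then show ?thesis using assms(1) Low by auto
  next
    case 2
    then show ?thesis using assms(1) SizeFn by auto
  next
    case 3
    then show ?thesis using assms(1) CostFn by auto
  qed
qed

section \<open>Application of costs: domains and monotonicity\<close>

lemma cost_app_dom:
  assumes "c \<in> cost_dom I (\<sigma> \<Rrightarrow> \<tau>)" "ord (\<sigma> \<Rrightarrow> \<tau>) \<le> 2"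
    and "d \<in> cost_dom I \<sigma>" "u \<in> size_dom I \<sigma>"
  shows "cost_app c d u \<in> cost_dom I \<tau>"
  using assms(1,2)
proof (cases rule: cost_dom_ArrowE)
  case (Low f)
  then show ?thesis using assms(4) by (auto simp: cost_dom_low dest: mono_funs_in)
next
  case (SizeFn f)
  then show ?thesis using assms(4) by (auto dest: mono_funs_in)
next
  case (CostFn f)
  then obtain d1 where d: "d = Low d1" "d1 \<in> cost1_dom I \<sigma>"
    using assms(3) cost_dom_low[of \<sigma> I] by auto
  show ?thesis
    using mono_funs_in[OF mono_funs_in[OF CostFn(3) d(2)] assms(4)] CostFn(1) d(1) by simp
qed

lemma cost_app_mono_left:
  assumes "c \<in> cost_dom I (\<sigma> \<Rrightarrow> \<tau>)" "c' \<in> cost_dom I (\<sigma> \<Rrightarrow> \<tau>)" "ord (\<sigma> \<Rrightarrow> \<tau>) \<le> 2"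
    and "cost_ge I (\<sigma> \<Rrightarrow> \<tau>) c c'" "d \<in> cost_dom I \<sigma>" "u \<in> size_dom I \<sigma>"
  shows "cost_ge I \<tau> (cost_app c d u) (cost_app c' d u)"
  using assms(1,3)
proof (cases rule: cost_dom_ArrowE)
  case (Low f)
  from assms(2,3) show ?thesis
    by (cases rule: cost_dom_ArrowE) (use Low assms in \<open>auto simp: pointwise_def\<close>)
next
  case (SizeFn f)
  from assms(2,3) show ?thesis
    by (cases rule: cost_dom_ArrowE) (use SizeFn assms in \<open>auto simp: pointwise_def\<close>)
next
  case (CostFn f)
  then obtain d1 where "d = Low d1" "d1 \<in> cost1_dom I \<sigma>"
    using assms(5) cost_dom_low[of \<sigma> I] by auto
  from assms(2,3) this show ?thesis
    by (cases rule: cost_dom_ArrowE) (use CostFn assms in \<open>auto simp: pointwise_def\<close>)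
qed

text \<open>The costs \<open>d\<close> and \<open>d'\<close> are compared only if
  \<open>ord \<sigma> \<noteq> 0\<close>: at a base type \<open>cost_app\<close> looks at the size
  alone. This is what absorbs a cost increase at a contracted redex.\<close>

lemma cost_app_mono_right:
  assumes "c \<in> cost_dom I (\<sigma> \<Rrightarrow> \<tau>)" "ord (\<sigma> \<Rrightarrow> \<tau>) \<le> 2"
    and "d \<in> cost_dom I \<sigma>" "d' \<in> cost_dom I \<sigma>" "ord \<sigma> \<noteq> 0 \<Longrightarrow> cost_ge I \<sigma> d d'"
    and "u \<in> size_dom I \<sigma>" "u' \<in> size_dom I \<sigma>" "size_ge I \<sigma> u u'"
  shows "cost_ge I \<tau> (cost_app c d u) (cost_app c d' u')"
  using assms(1,2)
proof (cases rule: cost_dom_ArrowE)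
  case (Low f)
  then show ?thesis using mono_funs_mono[OF Low(4) assms(6-8)] by simp
next
  case (SizeFn f)
  then show ?thesis using mono_funs_mono[OF SizeFn(4) assms(6-8)] by simp
next
  case (CostFn f)
  then obtain d1 d1' where d: "d = Low d1" "d1 \<in> cost1_dom I \<sigma>"
    "d' = Low d1'" "d1' \<in> cost1_dom I \<sigma>"
    using assms(3,4) cost_dom_low[of \<sigma> I] by auto
  \<comment> \<open>With an argument of order 1, first the cost is lowered at fixed size
    \<open>u\<close>, then the size at fixed cost \<open>d1'\<close>.\<close>
  have "cost1_ge I \<sigma> d1 d1'" using assms(5) d CostFn by simp
  then have "cost_ge I \<tau> (f d1 u) (f d1' u)"
    using mono_funs_mono[OF CostFn(3) d(2,4)] assms(6) by (simp add: pointwise_def)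
  moreover have "cost_ge I \<tau> (f d1' u) (f d1' u')"
    using mono_funs_mono[OF mono_funs_in[OF CostFn(3) d(4)] assms(6-8)] .
  ultimately have "cost_ge I \<tau> (f d1 u) (f d1' u')" by (rule cost_ge_trans)
  then show ?thesis using CostFn(1) d by simp
qed

lemma cost_ge_Base: "cost_ge I (Base \<iota>) c d \<Longrightarrow> nat_of_cost d \<le> nat_of_cost c"
proof -
  assume ge: "cost_ge I (Base \<iota>) c d"
  then obtain c1 d1 where "c = Low c1" "d = Low d1"
    by (cases c; cases d) simp_all
  with ge show ?thesis by (cases c1; cases d1) simp_all
qed

section \<open>Cost sums and substitution\<close>

lemma total_cost'_App:
  "total_cost' F R I \<alpha> \<zeta> (s \<cdot> t) =
    (if base_nonvar F (s \<cdot> t) \<and> \<not> normal_form F R (s \<cdot> t)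
      then nat_of_cost (cost_of I \<alpha> \<zeta> (s \<cdot> t)) else 0)
    + total_cost' F R I \<alpha> \<zeta> s + total_cost' F R I \<alpha> \<zeta> t"
  by (simp add: total_cost'_def counted'_def)

lemma total_cost'_normal_form:
  "(\<And>u. u \<in># subterms s \<Longrightarrow> normal_form F R u) \<Longrightarrow> total_cost' F R I \<alpha> \<zeta> s = 0"
  by (auto simp: total_cost'_def counted'_def)

lemma total_cost_App:
  "total_cost F I \<alpha> \<zeta> (s \<cdot> t) =
    (if base_nonvar F (s \<cdot> t) then nat_of_cost (cost_of I \<alpha> \<zeta> (s \<cdot> t)) else 0)
    + total_cost F I \<alpha> \<zeta> s + total_cost F I \<alpha> \<zeta> t"
  by (simp add: total_cost_def counted_def)

text \<open>The backward direction rests on uniqueness of types: \<open>\<gamma> x\<close> has type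
  \<open>snd x\<close>, hence no other. It makes an application count as a base-type subterm before
  substitution exactly when it does afterwards.\<close>

lemma has_type_subst_iff:
  assumes "substitution F \<gamma>"
  shows "has_type F (subst \<gamma> s) \<sigma> \<longleftrightarrow> has_type F s \<sigma>"
proof
  show "has_type F (subst \<gamma> s) \<sigma> \<Longrightarrow> has_type F s \<sigma>"
  proof (induction s arbitrary: \<sigma>)
    case (Var x)
    then have "\<sigma> = snd x"
      using assms has_type_unique[of F "\<gamma> x"] by (auto simp only: substitution_def subst.simps)
    then show ?case by (simp add: has_type.intros(1))
  next
    case (App s t)
    from App.prems obtain \<tau> where
      "has_type F (subst \<gamma> s) (\<tau> \<Rrightarrow> \<sigma>)" "has_type F (subst \<gamma> t) \<tau>"
      unfolding subst.simps by (rule has_type_AppE)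
    then show ?case by (intro has_type.intros(3) App.IH)
  qed simp
qed (rule has_type_subst[OF _ assms])

text \<open>Subterms inside some \<open>\<gamma> x\<close> are normal and contribute nothing. The
  others come from non-variable positions of \<open>s\<close> and keep their cost under the primed
  valuations. Some of these may be normal forms after substitution, hence only an
  inequality.\<close>

lemma total_cost'_subst:
  assumes "substitution F \<gamma>"
    and "\<And>x u. x \<in> vars s \<Longrightarrow> u \<in># subterms (\<gamma> x) \<Longrightarrow> normal_form F R u"
    and "\<And>x. x \<in> vars s \<Longrightarrow> \<alpha>' x = size_of I \<alpha> (\<gamma> x)"
    and "\<And>x. x \<in> vars s \<Longrightarrow> \<zeta>' x = cost_of I \<alpha> \<zeta> (\<gamma> x)"
  shows "total_cost' F R I \<alpha> \<zeta> (subst \<gamma> s) \<le> total_cost F I \<alpha>' \<zeta>' s"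
  using assms(2-)
proof (induction s)
  case (Var x)
  then show ?case by (simp add: total_cost'_normal_form)
next
  case (Sym f)
  then show ?case
    by (simp add: total_cost'_def counted'_def total_cost_def counted_def)
next
  case (App s t)
  have "total_cost' F R I \<alpha> \<zeta> (subst \<gamma> s) \<le> total_cost F I \<alpha>' \<zeta>' s"
    "total_cost' F R I \<alpha> \<zeta> (subst \<gamma> t) \<le> total_cost F I \<alpha>' \<zeta>' t"
    using App by auto
  moreover have "base_nonvar F (subst \<gamma> s \<cdot> subst \<gamma> t) \<longleftrightarrow> base_nonvar F (s \<cdot> t)"
    using has_type_subst_iff[OF assms(1), of "s \<cdot> t"] by (simp add: base_nonvar_def)
  moreover have "cost_of I \<alpha> \<zeta> (subst \<gamma> s \<cdot> subst \<gamma> t) = cost_of I \<alpha>' \<zeta>' (s \<cdot> t)"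
    using cost_of_subst[of "s \<cdot> t" \<alpha>' I \<alpha> \<gamma> \<zeta>' \<zeta>] App.prems(2,3) by (simp del: cost_of.simps)
  ultimately show ?case
    unfolding subst.simps total_cost'_App total_cost_App by (intro add_mono) simp_all
qed

section \<open>Rules, typing and domains in a compatible interpretation\<close>

locale interpreted_strs =
  fixes F :: "'f \<Rightarrow> 'b ty" and R :: "('f, 'b) rules"
    and N :: nat and I :: "('f, 'b, 'u) interp"
    and \<alpha> :: "'b var \<Rightarrow> 'u" and \<zeta> :: "'b var \<Rightarrow> 'u cost"
  assumes strs: "strs F R"
    and N: "2 \<le> N"
    and interp: "cost_size_interpretation F N I"
    and compat: "compatible F R N I"
    and size_val: "size_valuation N I \<alpha>" and cost_val: "cost_valuation I \<zeta>"
begin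

lemma sig: "signature F" using strs by (simp add: strs_def)

lemma size_str: "size_structure N I"
  using interp by (simp add: cost_size_interpretation_def)

lemma rule_type: "(l, r) \<in> R \<Longrightarrow> \<exists>\<iota>. has_type F l (Base \<iota>) \<and> has_type F r (Base \<iota>)"
  and rule_head: "(l, r) \<in> R \<Longrightarrow> \<exists>f ls. l = foldl App (Sym f) ls"
  and rule_vars: "(l, r) \<in> R \<Longrightarrow> vars r \<subseteq> vars l"
  using strs by (auto simp: strs_def)

lemma lhs_not_Var: "(l, r) \<in> R \<Longrightarrow> l \<noteq> Var x"
proof -
  have "foldl App (Sym f) ls \<noteq> Var x" for f ls
    \<comment> \<open>Splitting off the last argument exposes the outermost \<open>App\<close> of
      the spine.\<close>
    by (cases ls rule: rev_cases) auto
  then show "(l, r) \<in> R \<Longrightarrow> l \<noteq> Var x" using rule_head by metis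
qed

text \<open>Subject reduction: both sides of a rule share a base type, which \<open>\<gamma>\<close>
  preserves.\<close>

lemma step_has_type: "step F R s t \<Longrightarrow> has_type F s \<sigma> \<Longrightarrow> has_type F t \<sigma>"
proof (induction arbitrary: \<sigma> rule: step.induct)
  case (root l r \<gamma>)
  then show ?case
    using rule_type[OF root(1)] has_type_subst has_type_unique by metis
qed (blast elim: has_type_AppE intro: has_type.intros(3))+

lemma step_vars: "step F R s t \<Longrightarrow> vars t \<subseteq> vars s"
  by (induction rule: step.induct) (auto simp: vars_subst dest: rule_vars)

lemma size_of_dom:
  "has_type F s \<sigma> \<Longrightarrow> \<forall>x\<in>vars s. ord (snd x) \<le> N \<Longrightarrow> size_of I \<alpha> s \<in> size_dom I \<sigma>"
proof (induction rule: has_type.induct)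
  case (1 x)
  then show ?case
    using size_val unfolding size_valuation_def by (metis singletonI size_of.simps(1) vars.simps(1))
next
  case (2 f)
  then show ?case using interp by (simp add: cost_size_interpretation_def)
next
  case (3 s \<sigma> \<tau> t)
  have "\<forall>x\<in>vars s. ord (snd x) \<le> N" "\<forall>x\<in>vars t. ord (snd x) \<le> N" using "3.prems" by auto
  then show ?case
    unfolding size_of.simps
    \<comment> \<open>\<open>has_type_ord\<close> keeps the type of the function part within order
      \<open>N\<close>, where \<open>size_structure\<close> describes its domain.\<close>
    by (intro size_structure_app(1)[OF size_str has_type_ord[OF "3.hyps"(1) sig N]] "3.IH")
qed

lemma cost_of_dom:
  "has_type F s \<sigma> \<Longrightarrow> \<forall>x\<in>vars s. ord (snd x) \<le> 2 \<Longrightarrow> cost_of I \<alpha> \<zeta> s \<in> cost_dom I \<sigma>"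
proof (induction rule: has_type.induct)
  case (1 x)
  then show ?case
    using cost_val unfolding cost_valuation_def by (metis singletonI cost_of.simps(1) vars.simps(1))
next
  case (2 f)
  then show ?case using interp by (simp add: cost_size_interpretation_def)
next
  case (3 s \<sigma> \<tau> t)
  have v: "\<forall>x\<in>vars s. ord (snd x) \<le> 2" "\<forall>x\<in>vars t. ord (snd x) \<le> 2" using "3.prems" by auto
  then have vN: "\<forall>x\<in>vars t. ord (snd x) \<le> N" using N by (blast intro: order_trans)
  show ?case
    unfolding cost_of.simps
    by (rule cost_app_dom[OF "3.IH"(1)[OF v(1)] has_type_ord[OF "3.hyps"(1) sig order_refl v(1)]
        "3.IH"(2)[OF v(2)] size_of_dom[OF "3.hyps"(2) vN]])
qed

section \<open>Sizes and costs along a step\<close>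

lemma size_of_step:
  "step F R s t \<Longrightarrow> has_type F s \<sigma> \<Longrightarrow> \<forall>x\<in>vars s. ord (snd x) \<le> N \<Longrightarrow>
    size_ge I \<sigma> (size_of I \<alpha> s) (size_of I \<alpha> t)"
proof (induction arbitrary: \<sigma> rule: step.induct)
  case (root l r \<gamma>)
  \<comment> \<open>Outside \<open>vars l\<close> the variables of \<open>\<gamma> x\<close> may
    have order above \<open>N\<close>, so the old value is kept there to make
    \<open>\<alpha>'\<close> a valuation.\<close>
  define \<alpha>' where "\<alpha>' = (\<lambda>x. if x \<in> vars l then size_of I \<alpha> (\<gamma> x) else \<alpha> x)"
  have "has_type F (\<gamma> x) (snd x)" for x using root(2) unfolding substitution_def by blast
  moreover have "\<forall>y\<in>vars (\<gamma> x). ord (snd y) \<le> N" if "x \<in> vars l" for x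
    using root(5) that by (auto simp: vars_subst)
  ultimately have "size_valuation N I \<alpha>'"
    using size_val size_of_dom unfolding size_valuation_def \<alpha>'_def by metis
  moreover obtain \<iota> where \<iota>: "has_type F l (Base \<iota>)" using rule_type[OF root(1)] by blast
  \<comment> \<open>Compatibility quantifies over all valuations, so it may be used at
    \<open>\<alpha>'\<close> although \<open>\<alpha>\<close> is fixed in the locale.\<close>
  ultimately have "size_ge I (Base \<iota>) (size_of I \<alpha>' l) (size_of I \<alpha>' r)"
    using compat root(1) cost_val unfolding compatible_def by blast
  moreover have "\<sigma> = Base \<iota>"
    using has_type_unique[OF root(4) has_type_subst[OF \<iota> root(2)]] .
  moreover have "size_of I \<alpha> (subst \<gamma> l) = size_of I \<alpha>' l"
    "size_of I \<alpha> (subst \<gamma> r) = size_of I \<alpha>' r"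
    using rule_vars[OF root(1)] by (auto intro!: size_of_subst simp: \<alpha>'_def)
  ultimately show ?case by simp
next
  case (left s u t)
  from left(3) obtain \<tau> where s: "has_type F s (\<tau> \<Rrightarrow> \<sigma>)" and t: "has_type F t \<tau>"
    by (rule has_type_AppE)
  from left.IH[OF s] size_of_dom[OF t] left(4) show ?case by (simp add: pointwise_def)
next
  case (right s u t)
  from right(3) obtain \<tau> where t: "has_type F t (\<tau> \<Rrightarrow> \<sigma>)" and s: "has_type F s \<tau>"
    by (rule has_type_AppE)
  have ordN: "ord (\<tau> \<Rrightarrow> \<sigma>) \<le> N" using has_type_ord[OF t sig N] right(4) by simp
  have vN: "\<forall>x\<in>vars s. ord (snd x) \<le> N" "\<forall>x\<in>vars u. ord (snd x) \<le> N"
      "\<forall>x\<in>vars t. ord (snd x) \<le> N"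
    using step_vars[OF right(1)] right(4) by auto
  show ?case
    unfolding size_of.simps
    by (rule size_structure_app(2)[OF size_str ordN size_of_dom[OF t vN(3)]
        size_of_dom[OF s vN(1)] size_of_dom[OF step_has_type[OF right(1) s] vN(2)]
        right.IH[OF s vN(1)]])
qed

lemma cost_of_step_left:
  assumes "step F R s u" "has_type F (s \<cdot> t) \<sigma>" "\<forall>x\<in>vars (s \<cdot> t). ord (snd x) \<le> 2"
    and "\<And>\<tau>. has_type F s \<tau> \<Longrightarrow> ord \<tau> \<noteq> 0 \<Longrightarrow> cost_ge I \<tau> (cost_of I \<alpha> \<zeta> s) (cost_of I \<alpha> \<zeta> u)"
  shows "cost_ge I \<sigma> (cost_of I \<alpha> \<zeta> (s \<cdot> t)) (cost_of I \<alpha> \<zeta> (u \<cdot> t))"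
proof -
  from assms(2) obtain \<tau> where s: "has_type F s (\<tau> \<Rrightarrow> \<sigma>)" and t: "has_type F t \<tau>"
    by (rule has_type_AppE)
  have ord2: "ord (\<tau> \<Rrightarrow> \<sigma>) \<le> 2" using has_type_ord[OF s sig order_refl] assms(3) by simp
  have v2: "\<forall>x\<in>vars s. ord (snd x) \<le> 2" "\<forall>x\<in>vars u. ord (snd x) \<le> 2"
      "\<forall>x\<in>vars t. ord (snd x) \<le> 2"
    using step_vars[OF assms(1)] assms(3) by auto
  have vN: "\<forall>x\<in>vars t. ord (snd x) \<le> N" using v2 N by (blast intro: order_trans)
  have "cost_ge I (\<tau> \<Rrightarrow> \<sigma>) (cost_of I \<alpha> \<zeta> s) (cost_of I \<alpha> \<zeta> u)" using assms(4)[OF s] by simp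
  then show ?thesis
    unfolding cost_of.simps
    by (rule cost_app_mono_left[OF cost_of_dom[OF s v2(1)]
        cost_of_dom[OF step_has_type[OF assms(1) s] v2(2)] ord2 _
        cost_of_dom[OF t v2(3)] size_of_dom[OF t vN]])
qed

text \<open>The size of the argument decreases by \<open>size_of_step\<close>; its cost is compared
  only when its type is not a base type, the case in which the surrounding cost can depend on
  it.\<close>

lemma cost_of_step_right:
  assumes "step F R s u" "has_type F (t \<cdot> s) \<sigma>" "\<forall>x\<in>vars (t \<cdot> s). ord (snd x) \<le> 2"
    and "\<And>\<tau>. has_type F s \<tau> \<Longrightarrow> ord \<tau> \<noteq> 0 \<Longrightarrow> cost_ge I \<tau> (cost_of I \<alpha> \<zeta> s) (cost_of I \<alpha> \<zeta> u)"
  shows "cost_ge I \<sigma> (cost_of I \<alpha> \<zeta> (t \<cdot> s)) (cost_of I \<alpha> \<zeta> (t \<cdot> u))"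
proof -
  from assms(2) obtain \<tau> where t: "has_type F t (\<tau> \<Rrightarrow> \<sigma>)" and s: "has_type F s \<tau>"
    by (rule has_type_AppE)
  have u: "has_type F u \<tau>" using step_has_type[OF assms(1) s] .
  have ord2: "ord (\<tau> \<Rrightarrow> \<sigma>) \<le> 2" using has_type_ord[OF t sig order_refl] assms(3) by simp
  have v2: "\<forall>x\<in>vars s. ord (snd x) \<le> 2" "\<forall>x\<in>vars u. ord (snd x) \<le> 2"
      "\<forall>x\<in>vars t. ord (snd x) \<le> 2"
    using step_vars[OF assms(1)] assms(3) by auto
  have vN: "\<forall>x\<in>vars s. ord (snd x) \<le> N" "\<forall>x\<in>vars u. ord (snd x) \<le> N"
    using v2 N by (blast intro: order_trans)+
  show ?thesis
    unfolding cost_of.simps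
    by (rule cost_app_mono_right[OF cost_of_dom[OF t v2(3)] ord2 cost_of_dom[OF s v2(1)]
        cost_of_dom[OF u v2(2)] assms(4)[OF s] size_of_dom[OF s vN(1)] size_of_dom[OF u vN(2)]
        size_of_step[OF assms(1) s vN(1)]])
qed

text \<open>Base types are excluded because compatibility does not bound the cost of a right-hand
  side that is a variable. For the other types the step takes place strictly inside
  \<open>s\<close>.\<close>

lemma cost_of_step:
  "step F R s t \<Longrightarrow> has_type F s \<sigma> \<Longrightarrow> \<forall>x\<in>vars s. ord (snd x) \<le> 2 \<Longrightarrow> ord \<sigma> \<noteq> 0 \<Longrightarrow>
    cost_ge I \<sigma> (cost_of I \<alpha> \<zeta> s) (cost_of I \<alpha> \<zeta> t)"
proof (induction arbitrary: \<sigma> rule: step.induct)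
  case (root l r \<gamma>)
  obtain \<iota> where "has_type F l (Base \<iota>)" using rule_type[OF root(1)] by blast
  then have "\<sigma> = Base \<iota>" using has_type_unique has_type_subst root by metis
  \<comment> \<open>A root step happens at a base type, which contradicts
    \<open>ord \<sigma> \<noteq> 0\<close>.\<close>
  then show ?case using root by simp
next
  case (left s u t)
  then show ?case by (intro cost_of_step_left) auto
next
  case (right s u t)
  then show ?case by (intro cost_of_step_right) auto
qed

section \<open>Decrease of the total cost\<close>

lemma total_cost'_root:
  assumes "(l, r) \<in> R" "substitution F \<gamma>"
    and "\<And>u. u \<in># subterms (subst \<gamma> l) \<Longrightarrow> u \<noteq> subst \<gamma> l \<Longrightarrow> \<not> redex F R u"
    and "\<forall>u\<in>#counted' F R (subst \<gamma> l). cost_defined F u"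
  shows "total_cost' F R I \<alpha> \<zeta> (subst \<gamma> r) < total_cost' F R I \<alpha> \<zeta> (subst \<gamma> l)"
proof -
  let ?s = "subst \<gamma> l"
  have nf: "normal_form F R u" if "u \<in># subterms v" "v \<in># subterms ?s" "v \<noteq> ?s" for u v
  proof -
    \<comment> \<open>Sizes of terms separate proper subterms from \<open>?s\<close>, so every
      subterm \<open>w\<close> of \<open>v\<close> is again different from \<open>?s\<close> and
      thus no redex.\<close>
    have v: "size v < size ?s"
      using that(2,3) subterm_size
      by (cases ?s) (fastforce simp: less_Suc_eq_le intro: trans_le_add1 trans_le_add2)+
    have "\<not> redex F R w" if "w \<in># subterms u" for w
    proof -
      have "w \<in># subterms v" using that \<open>u \<in># subterms v\<close> by (rule subterms_trans)
      then have "w \<in># subterms ?s" "w \<noteq> ?s"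
        using subterms_trans \<open>v \<in># subterms ?s\<close> subterm_size[of w v] v by auto
      then show ?thesis using assms(3) by blast
    qed
    then show ?thesis unfolding normal_form_def using step_redex by metis
  qed
  have st: "step F R ?s (subst \<gamma> r)" using assms by (intro step.root)
  obtain \<iota> where \<iota>: "has_type F l (Base \<iota>)" using rule_type[OF assms(1)] by blast
  have not_Var: "?s \<noteq> Var x" for x
    using lhs_not_Var[OF assms(1)] by (cases l) auto
  have cnt: "base_nonvar F ?s \<and> \<not> normal_form F R ?s"
    using has_type_subst[OF \<iota> assms(2)] st not_Var by (auto simp: base_nonvar_def normal_form_def)
  then have "?s \<in># counted' F R ?s"
    by (simp add: counted'_def subterm_refl)
  \<comment> \<open>Since \<open>?s\<close> is itself counted, its cost is defined, and this bounds
    the orders of all variables in it.\<close>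
  then have ord1: "\<forall>x\<in>vars ?s. ord (snd x) \<le> 1"
    using assms(4) by (auto simp: cost_defined_def)

  define \<alpha>' where "\<alpha>' = (\<lambda>x. if x \<in> vars l then size_of I \<alpha> (\<gamma> x) else \<alpha> x)"
  define \<zeta>' where "\<zeta>' = (\<lambda>x. if x \<in> vars l then cost_of I \<alpha> \<zeta> (\<gamma> x) else \<zeta> x)"
  have ty: "has_type F (\<gamma> x) (snd x)" for x using assms(2) unfolding substitution_def by blast
  have "ord (snd y) \<le> 1" if "x \<in> vars l" "y \<in> vars (\<gamma> x)" for x y
    using ord1 that by (auto simp: vars_subst)
  then have o: "\<forall>y\<in>vars (\<gamma> x). ord (snd y) \<le> 2" "\<forall>y\<in>vars (\<gamma> x). ord (snd y) \<le> N"
    if "x \<in> vars l" for x using that N by fastforce+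
  have "size_valuation N I \<alpha>'"
    using size_val size_of_dom ty o(2) unfolding size_valuation_def \<alpha>'_def by metis
  moreover have "cost_valuation I \<zeta>'"
    using cost_val cost_of_dom ty o(1) unfolding cost_valuation_def \<zeta>'_def by metis
  ultimately have less: "total_cost F I \<alpha>' \<zeta>' r < nat_of_cost (cost_of I \<alpha>' \<zeta>' l)"
    using compat assms(1) unfolding compatible_def by blast

  \<comment> \<open>A variable of \<open>r\<close> occurs in \<open>l\<close>, and \<open>l\<close>
    is an application, so \<open>\<gamma> x\<close> lies properly inside the redex and innermost
    rewriting makes its subterms normal.\<close>
  have x_nf: "normal_form F R u" if "x \<in> vars r" "u \<in># subterms (\<gamma> x)" for x u
  proof -
    have x: "x \<in> vars l" using rule_vars[OF assms(1)] that by auto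
    then obtain l1 l2 where l: "l = l1 \<cdot> l2"
      using lhs_not_Var[OF assms(1)] by (metis empty_iff trm.exhaust vars.simps(2))
    then have "\<gamma> x \<in># subterms (subst \<gamma> l1) \<or> \<gamma> x \<in># subterms (subst \<gamma> l2)"
      using x subst_var_subterm[of x l1 \<gamma>] subst_var_subterm[of x l2 \<gamma>] by auto
    then have "\<gamma> x \<in># subterms ?s" "\<gamma> x \<noteq> ?s"
      using l App_not_proper_subterm[of "subst \<gamma> l1" "subst \<gamma> l2"] by auto
    then show ?thesis using nf that(2) by blast
  qed
  have "total_cost' F R I \<alpha> \<zeta> (subst \<gamma> r) \<le> total_cost F I \<alpha>' \<zeta>' r"
    using assms(2) rule_vars[OF assms(1)]
    by (intro total_cost'_subst x_nf) (auto simp: \<alpha>'_def \<zeta>'_def)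
  also note less
  also have "cost_of I \<alpha>' \<zeta>' l = cost_of I \<alpha> \<zeta> ?s"
    by (intro cost_of_subst[symmetric]) (auto simp: \<alpha>'_def \<zeta>'_def)
  \<comment> \<open>The cost of \<open>?s\<close> is one summand of a sum of natural
    numbers.\<close>
  also have "nat_of_cost \<dots> \<le> total_cost' F R I \<alpha> \<zeta> ?s"
    using multi_member_split[OF \<open>?s \<in># counted' F R ?s\<close>] by (auto simp: total_cost'_def)
  finally show ?thesis .
qed

text \<open>In a context the component containing the redex decreases strictly, the other component
  is unchanged, and the summand of the whole application does not grow. That summand is present
  before the step, as the application is reducible, and may vanish afterwards.\<close>

lemma total_cost'_step:
  "step F R s t \<Longrightarrow> has_type F s \<sigma> \<Longrightarrow> \<forall>u\<in>#counted' F R s. cost_defined F u \<Longrightarrow>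
    total_cost' F R I \<alpha> \<zeta> t < total_cost' F R I \<alpha> \<zeta> s"
proof (induction arbitrary: \<sigma> rule: step.induct)
  case (root l r \<gamma>)
  then show ?case by (intro total_cost'_root)
next
  case (left s u t)
  \<comment> \<open>Subject reduction gives one direction; uniqueness of the type of the reduct
    gives the other.\<close>
  have "has_type F (s \<cdot> t) \<tau> \<longleftrightarrow> has_type F (u \<cdot> t) \<tau>" for \<tau>
    using left(3) step_has_type[OF step.left[OF left(1)]] has_type_unique by metis
  then have "base_nonvar F (s \<cdot> t) \<longleftrightarrow> base_nonvar F (u \<cdot> t)"
    by (simp add: base_nonvar_def)
  moreover have nnf: "\<not> normal_form F R (s \<cdot> t)"
    using step.left[OF left(1)] by (auto simp: normal_form_def)
  moreover have "nat_of_cost (cost_of I \<alpha> \<zeta> (u \<cdot> t)) \<le> nat_of_cost (cost_of I \<alpha> \<zeta> (s \<cdot> t))"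
    if nv: "base_nonvar F (s \<cdot> t)"
  proof -
    obtain \<iota> where \<iota>: "has_type F (s \<cdot> t) (Base \<iota>)" using nv unfolding base_nonvar_def by blast
    have "cost_defined F (s \<cdot> t)"
      using left(4) nnf nv by (auto simp: counted'_def)
    then have o: "\<forall>x\<in>vars (s \<cdot> t). ord (snd x) \<le> 2"
      unfolding cost_defined_def by (meson order_trans one_le_numeral)
    show ?thesis
      by (rule cost_ge_Base[OF cost_of_step_left[OF left(1) \<iota> o cost_of_step[OF left(1)]]])
        (use o in auto)
  qed
  \<comment> \<open>The counted subterms of \<open>s\<close> are among those of
    \<open>s \<cdot> t\<close>, so the induction hypothesis finds their costs defined.\<close>
  moreover have "total_cost' F R I \<alpha> \<zeta> u < total_cost' F R I \<alpha> \<zeta> s"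
    using left by (auto simp: counted'_def elim!: has_type_AppE)
  ultimately show ?case
    by (auto simp: total_cost'_App simp del: cost_of.simps intro: add_le_less_mono)
next
  case (right s u t)
  have "has_type F (t \<cdot> s) \<tau> \<longleftrightarrow> has_type F (t \<cdot> u) \<tau>" for \<tau>
    using right(3) step_has_type[OF step.right[OF right(1)]] has_type_unique by metis
  then have "base_nonvar F (t \<cdot> s) \<longleftrightarrow> base_nonvar F (t \<cdot> u)"
    by (simp add: base_nonvar_def)
  moreover have nnf: "\<not> normal_form F R (t \<cdot> s)"
    using step.right[OF right(1)] by (auto simp: normal_form_def)
  moreover have "nat_of_cost (cost_of I \<alpha> \<zeta> (t \<cdot> u)) \<le> nat_of_cost (cost_of I \<alpha> \<zeta> (t \<cdot> s))"
    if nv: "base_nonvar F (t \<cdot> s)"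
  proof -
    obtain \<iota> where \<iota>: "has_type F (t \<cdot> s) (Base \<iota>)" using nv unfolding base_nonvar_def by blast
    have "cost_defined F (t \<cdot> s)"
      using right(4) nnf nv by (auto simp: counted'_def)
    then have o: "\<forall>x\<in>vars (t \<cdot> s). ord (snd x) \<le> 2"
      unfolding cost_defined_def by (meson order_trans one_le_numeral)
    show ?thesis
      \<comment> \<open>If \<open>s\<close> has a base type, \<open>cost_of_step\<close> is silent
        about its cost, and the comparison rests on its size alone.\<close>
      by (rule cost_ge_Base[OF cost_of_step_right[OF right(1) \<iota> o cost_of_step[OF right(1)]]])
        (use o in auto)
  qed
  moreover have "total_cost' F R I \<alpha> \<zeta> u < total_cost' F R I \<alpha> \<zeta> s"
    using right by (auto simp: counted'_def elim!: has_type_AppE)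
  ultimately show ?case
    by (auto simp: total_cost'_App simp del: cost_of.simps intro: add_le_less_mono)
qed

end

theorem theorem3p1:
  fixes F :: "'f \<Rightarrow> 'b ty" and R :: "('f, 'b) rules"
    and N :: nat and I :: "('f, 'b, 'u) interp"
    and \<alpha> :: "'b var \<Rightarrow> 'u" and \<zeta> :: "'b var \<Rightarrow> 'u cost"
    and s t :: "('f, 'b) trm" and \<sigma> :: "'b ty"
  assumes "strs F R"
    and "2 \<le> N"
    and "cost_size_interpretation F N I"
    and "compatible F R N I"
    and "size_valuation N I \<alpha>" and "cost_valuation I \<zeta>"
    and "has_type F s \<sigma>" and "has_type F t \<sigma>"
    and "\<forall>x\<in>vars s \<union> vars t. ord (snd x) \<le> N"
    and "\<forall>u\<in>#counted' F R s. cost_defined F u"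
    and "\<forall>u\<in>#counted' F R t. cost_defined F u"
    and "step F R s t"
  shows "total_cost' F R I \<alpha> \<zeta> s > total_cost' F R I \<alpha> \<zeta> t \<and>
         size_ge I \<sigma> (size_of I \<alpha> s) (size_of I \<alpha> t)"
proof -
  interpret interpreted_strs F R N I \<alpha> \<zeta>
    using assms(1-6) by unfold_locales
  show ?thesis
    using total_cost'_step[OF assms(12,7,10)] size_of_step[OF assms(12,7)] assms(9) by simp
qed

end
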